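(* Fix an integer $k\ge 1$. For every integer $n\ge 0$, the number of partitions of $n$ satisfying condition (P) equals the number of partitions of $n$ satisfying condition (S), where: (P) every part is either a multiple of $3$ or congruent to $\pm 2 \pmod{3k+3}$. (S) all of the following hold: - the difference between adjacent parts is never $1$; - if the difference between two adjacent parts is in $\{2,5,\dots,3k-4\}$, then the smaller of these parts is $\not\equiv 2 \pmod 3$; - if the difference between two adjacent parts is in $\{4,7,\dots,3k-2\}$, then the smaller of these parts is $\equiv 1 \pmod 3$; - (initial condition, given by a fictitious zero) no part is equal to any of $1,4,\dots,3k-2$. Moreover, the generating function of the partitions satisfying (P) is the periodic infinite product $\prod_m (1-q^m)^{-1}$ over all $m\ge1$ with $3\mid m$ or $m\equiv\pm2\pmod{3k+3}$; and a partition satisfies (S) if and only if its conjugate satisfies the following condition (C): (C) all of the following hold: - no part appears exactly once; - if the frequency of a part belongs to $\{2,5,8,\dots,3k-4\}$, then the number of parts strictly greater than it is $\not\equiv 2\pmod 3$; - if the frequency of a part belongs to $\{4,7,10,\dots,3k-2\}$, then the number of parts strictly greater than it is $\equiv 1\pmod 3$.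
   Context: Partitions $\lambda=(\lambda_1\ge\lambda_2\ge\dots\ge\lambda_r)$ have positive integer parts; adjacent parts are $\lambda_i,\lambda_{i+1}$ for $1\le i<r$. The sets $\{2,5,\dots,3k-4\}$, $\{4,7,\dots,3k-2\}$ and the list $1,4,\dots,3k-2$ are arithmetic progressions with common difference $3$ (the first two are empty when $k=1$). The initial condition is "given by a fictitious zero" if it is what the difference conditions impose when one part equal to $0$ is appended to the partition. The frequency of a part is the number of times it occurs; numbers of parts are counted with multiplicity. The conjugate of a partition is obtained by transposing its Ferrers diagram. *)

theory Defs
  imports "HOL-Analysis.Analysis" "HOL-Number_Theory.Cong"
begin

definition is_partition :: "nat list \<Rightarrow> bool" where
  "is_partition xs \<longleftrightarrow> sorted_wrt (\<ge>) xs \<and> (\<forall>x\<in>set xs. x > 0)"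

definition partitions :: "nat \<Rightarrow> nat list set" where
  "partitions n = {xs. is_partition xs \<and> sum_list xs = n}"

lemma finite_partitions: "finite (partitions n)"
proof (rule finite_subset)
  have "length xs \<le> sum_list xs" if "\<forall>x\<in>set xs. x > 0" for xs :: "nat list"
    using that by (induction xs) auto
  then show "partitions n \<subseteq> {xs. set xs \<subseteq> {..n} \<and> length xs \<le> n}"
    using member_le_sum_list by (fastforce simp: partitions_def is_partition_def)
qed (simp add: finite_lists_length_le)

text \<open>Cells are pairs (row, column), both counted from 0.\<close>

definition ferrers :: "nat list \<Rightarrow> (nat \<times> nat) set" where
  "ferrers xs = {(i, j). i < length xs \<and> j < xs ! i}"

definition conjugate :: "nat list \<Rightarrow> nat list" where
  "conjugate xs = (THE ys. is_partition ys \<and> ferrers ys = (ferrers xs)\<inverse>)"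

lemma ferrers_inject:
  assumes "is_partition xs" "is_partition ys" "ferrers xs = ferrers ys"
  shows "xs = ys"
proof (rule nth_equalityI)
  have row: "(i, j) \<in> ferrers xs \<longleftrightarrow> (i, j) \<in> ferrers ys" for i j
    using assms(3) by simp
  have pos: "i < length zs \<longleftrightarrow> (i, 0) \<in> ferrers zs" if "is_partition zs" for i zs
    using that nth_mem[of i zs] unfolding ferrers_def is_partition_def by blast
  have "i < length xs \<longleftrightarrow> i < length ys" for i
    using row[of i 0] pos[OF assms(1)] pos[OF assms(2)] by simp
  then show len: "length xs = length ys"
    by (metis linorder_neqE_nat less_irrefl)
  show "xs ! i = ys ! i" if "i < length xs" for i
  proof -
    have "j < xs ! i \<longleftrightarrow> j < ys ! i" for j
      using row[of i j] that len by (auto simp: ferrers_def)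
    then show ?thesis
      by (metis linorder_neqE_nat less_irrefl)
  qed
qed

lemma ex_conjugate:
  assumes "is_partition xs"
  shows "\<exists>ys. is_partition ys \<and> ferrers ys = (ferrers xs)\<inverse>"
proof -
  define w where "w = (if xs = [] then 0 else hd xs)"
  define col where "col j = {i. i < length xs \<and> j < xs ! i}" for j
  define ys where "ys = map (\<lambda>j. card (col j)) [0..<w]"
  have anti: "xs ! i' \<le> xs ! i" if "i \<le> i'" "i' < length xs" for i i'
    using assms that by (cases "i = i'") (auto simp: is_partition_def sorted_wrt_iff_nth_less)
  have le_w: "xs ! i \<le> w" if "i < length xs" for i
    using anti[of 0 i] that by (cases xs) (auto simp: w_def)
  have col: "i < card (col j) \<longleftrightarrow> i \<in> col j" for i j
  proof -
    have fin: "finite (col j)" by (simp add: col_def)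
    have down: "i \<in> col j" if "i' \<in> col j" "i \<le> i'" for i i'
      using that anti[of i i'] by (auto simp: col_def)
    have lt: "i < card (col j)" if "i \<in> col j" for i
    proof -
      have "{..i} \<subseteq> col j" using down that by blast
      then have "card {..i} \<le> card (col j)" using fin by (rule card_mono[rotated])
      then show ?thesis by simp
    qed
    have "col j = {..<card (col j)}"
      by (rule card_subset_eq) (use lt in auto)
    then show ?thesis by blast
  qed
  have "card (col j') \<le> card (col j)" if "j \<le> j'" for j j'
    by (rule card_mono) (use that in \<open>auto simp: col_def\<close>)
  moreover have "card (col j) > 0" if "j < w" for j
  proof -
    have "0 \<in> col j" using that by (cases xs) (auto simp: w_def col_def)
    then have "0 < card (col j)" by (simp only: col)
    then show ?thesis .
  qed
  ultimately have "is_partition ys"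
    by (auto simp: is_partition_def ys_def sorted_wrt_iff_nth_less)
  moreover have "(j, i) \<in> ferrers ys \<longleftrightarrow> (i, j) \<in> ferrers xs" for i j
  proof -
    have "(j, i) \<in> ferrers ys \<longleftrightarrow> j < w \<and> i \<in> col j"
      by (auto simp: ferrers_def ys_def col)
    also have "\<dots> \<longleftrightarrow> (i, j) \<in> ferrers xs"
      using le_w[of i] by (auto simp: col_def ferrers_def)
    finally show ?thesis .
  qed
  then have "ferrers ys = (ferrers xs)\<inverse>" by auto
  ultimately show ?thesis by blast
qed

lemma conjugate:
  assumes "is_partition xs"
  shows "is_partition (conjugate xs)" and "ferrers (conjugate xs) = (ferrers xs)\<inverse>"
proof -
  have "\<exists>!ys. is_partition ys \<and> ferrers ys = (ferrers xs)\<inverse>"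
    using ex_conjugate[OF assms] ferrers_inject by metis
  from theI'[OF this]
  show "is_partition (conjugate xs)" and "ferrers (conjugate xs) = (ferrers xs)\<inverse>"
    by (simp_all add: conjugate_def)
qed

text \<open>The progressions 2, 5, \dots, 3k-4 and 4, 7, \dots, 3k-2 (empty for k = 1), and
  1, 4, \dots, 3k-2, written without truncated subtraction.\<close>

definition prog2 :: "nat \<Rightarrow> nat set" where
  "prog2 k = {3 * j + 2 | j. j + 2 \<le> k}"

definition prog4 :: "nat \<Rightarrow> nat set" where
  "prog4 k = {3 * j + 1 | j. 1 \<le> j \<and> j + 1 \<le> k}"

definition prog1 :: "nat \<Rightarrow> nat set" where
  "prog1 k = {3 * j + 1 | j. j + 1 \<le> k}"

definition admissible_part :: "nat \<Rightarrow> nat \<Rightarrow> bool" where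
  "admissible_part k m \<longleftrightarrow>
     3 dvd m \<or> [int m = 2] (mod (3 * int k + 3)) \<or> [int m = - 2] (mod (3 * int k + 3))"

definition cond_P :: "nat \<Rightarrow> nat list \<Rightarrow> bool" where
  "cond_P k xs \<longleftrightarrow> (\<forall>x\<in>set xs. admissible_part k x)"

text \<open>Meant for weakly decreasing lists, on which the subtraction is not truncated; a trailing
  zero is allowed.\<close>

definition difference_conditions :: "nat \<Rightarrow> nat list \<Rightarrow> bool" where
  "difference_conditions k xs \<longleftrightarrow>
     (\<forall>i. i + 1 < length xs \<longrightarrow>
        xs ! i - xs ! (i + 1) \<noteq> 1 \<and>
        (xs ! i - xs ! (i + 1) \<in> prog2 k \<longrightarrow> \<not> [xs ! (i + 1) = 2] (mod 3)) \<and>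
        (xs ! i - xs ! (i + 1) \<in> prog4 k \<longrightarrow> [xs ! (i + 1) = 1] (mod 3)))"

definition cond_S :: "nat \<Rightarrow> nat list \<Rightarrow> bool" where
  "cond_S k xs \<longleftrightarrow> difference_conditions k xs \<and> (\<forall>x\<in>set xs. x \<notin> prog1 k)"

definition num_greater :: "nat list \<Rightarrow> nat \<Rightarrow> nat" where
  "num_greater xs x = length (filter (\<lambda>y. y > x) xs)"

definition cond_C :: "nat \<Rightarrow> nat list \<Rightarrow> bool" where
  "cond_C k xs \<longleftrightarrow>
     (\<forall>x\<in>set xs.
        count_list xs x \<noteq> 1 \<and>
        (count_list xs x \<in> prog2 k \<longrightarrow> \<not> [num_greater xs x = 2] (mod 3)) \<and>
        (count_list xs x \<in> prog4 k \<longrightarrow> [num_greater xs x = 1] (mod 3)))"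

definition gf_P :: "nat \<Rightarrow> rat fps" where
  "gf_P k = Abs_fps (\<lambda>n. of_nat (card {xs \<in> partitions n. cond_P k xs}))"

end

theory Submission
  imports Defs
begin

text \<open>
  Write \<open>Q = 3 * k + 3\<close>. Both sides of the partition identity can be built from one family
  of partitions. Let \<open>0, 2, Q - 2, Q, Q + 2, 2 * Q - 2, 2 * Q, \<dots>\<close> (the function \<open>site k\<close>)
  enumerate the numbers congruent to \<open>0\<close> or \<open>\<plusminus>2\<close> modulo \<open>Q\<close>, and call a decreasing sequence
  of such numbers, ending in a fictitious zero, flat if the index drops by at most two from each
  entry to the next.

  Reading the difference conditions of (S) from the smallest part upwards, the residue modulo 3 of
  a part and that of the difference to the next larger one prescribe the least difference allowed:
  it is one of \<open>0\<close>, \<open>2\<close>, \<open>3 * k + 1\<close> above a part divisible by 3; one of \<open>0\<close>, \<open>2\<close>, \<open>4\<close> above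
  a part congruent to 1; and one of \<open>0\<close>, \<open>3 * k - 1\<close>, \<open>3 * k + 1\<close> above a part congruent to 2. These
  are exactly the differences by which a flat sequence can grow, and a larger difference exceeds
  the least one by a multiple of 3. So a partition satisfies (S) iff it is a flat sequence plus, entry
  by entry, a decreasing sequence of multiples of 3 (lemma \<open>S_factor\<close>). Similarly, an
  arbitrary partition into parts congruent to \<open>0\<close> or \<open>\<plusminus>2\<close> modulo \<open>Q\<close> is a flat sequence plus a
  decreasing sequence of multiples of \<open>Q\<close>, because raising the index by 3 raises the entry by
  \<open>Q\<close> (lemma \<open>site_parts_factor\<close>). The summands are unique in both cases: three consecutive
  values of \<open>site k\<close> are distinct modulo 3.

  With \<open>E m\<close> the generating function of the partitions into multiples of \<open>m\<close>, \<open>R\<close> that of the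
  partitions into parts congruent to \<open>\<plusminus>2\<close> modulo \<open>Q\<close>, \<open>F\<close> that of flat sequences, and \<open>S\<close> and
  \<open>P\<close> those of the partitions satisfying (S) and (P), this gives
  \<open>S * E Q = F * E 3 * E Q = (R * E Q) * E 3 = P * E Q\<close>, and \<open>E Q\<close> cancels.

  The equivalence with (C) holds since the frequency of \<open>x\<close> in the conjugate is the difference
  between the parts number \<open>x\<close> and \<open>x + 1\<close> of the partition, while the number of larger parts in the
  conjugate is part number \<open>x + 1\<close>.
\<close>

section \<open>Generating functions\<close>

definition gf :: "'a set \<Rightarrow> ('a \<Rightarrow> nat) \<Rightarrow> rat fps" where
  "gf A w = Abs_fps (\<lambda>n. of_nat (card {a \<in> A. w a = n}))"

lemma gf_nth: "fps_nth (gf A w) n = of_nat (card {a \<in> A. w a = n})"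
  by (simp add: gf_def)

lemma gf_bij_betw:
  assumes "bij_betw f A B" and "\<And>a. a \<in> A \<Longrightarrow> w' (f a) = w a"
  shows "gf B w' = gf A w"
proof (rule fps_ext)
  fix n
  have "bij_betw f {a \<in> A. w a = n} {b \<in> B. w' b = n}"
    using assms(1)
    by (rule bij_betw_subset) (use assms in \<open>auto simp: bij_betw_def\<close>)
  then show "fps_nth (gf B w') n = fps_nth (gf A w) n"
    by (simp add: gf_nth bij_betw_same_card)
qed

text \<open>If a fibre were infinite, its cardinality 0 could spoil the product formula.\<close>

lemma gf_times:
  assumes "\<And>n. finite {a \<in> A. v a = n}" and "\<And>n. finite {b \<in> B. w b = n}"
  shows "gf (A \<times> B) (\<lambda>(a, b). v a + w b) = gf A v * gf B w"
proof (rule fps_ext)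
  fix n
  let ?A = "\<lambda>i. {a \<in> A. v a = i}" and ?B = "\<lambda>i. {b \<in> B. w b = i}"
  have split: "{p \<in> A \<times> B. (case p of (a, b) \<Rightarrow> v a + w b) = n} =
      (\<Union>i\<in>{0..n}. ?A i \<times> ?B (n - i))"
    by auto
  have "card {p \<in> A \<times> B. (case p of (a, b) \<Rightarrow> v a + w b) = n} =
      (\<Sum>i=0..n. card (?A i \<times> ?B (n - i)))"
    unfolding split by (rule card_UN_disjoint) (use assms in \<open>auto intro!: finite_cartesian_product\<close>)
  then show "fps_nth (gf (A \<times> B) (\<lambda>(a, b). v a + w b)) n = fps_nth (gf A v * gf B w) n"
    by (simp add: gf_nth fps_mult_nth card_cartesian_product)
qed

lemma fps_mult_nth_cong:
  assumes "\<And>i. i \<le> n \<Longrightarrow> fps_nth f i = fps_nth f' i" and "\<And>i. i \<le> n \<Longrightarrow> fps_nth g i = fps_nth g' i"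
  shows "fps_nth (f * g) n = fps_nth (f' * g') n"
  by (simp add: fps_mult_nth assms)

section \<open>Partitions with parts in a given set\<close>

definition parts_gf :: "nat set \<Rightarrow> rat fps" where
  "parts_gf A = Abs_fps (\<lambda>n. of_nat (card {xs \<in> partitions n. set xs \<subseteq> A}))"

lemma parts_gf_nth: "fps_nth (parts_gf A) n = of_nat (card {xs \<in> partitions n. set xs \<subseteq> A})"
  by (simp add: parts_gf_def)

lemma parts_gf_cong_le:
  assumes "n \<le> N" shows "fps_nth (parts_gf (A \<inter> {..N})) n = fps_nth (parts_gf A) n"
proof -
  have "set xs \<subseteq> {..N}" if "xs \<in> partitions n" for xs
    using that assms member_le_sum_list by (fastforce simp: partitions_def)
  then have "{xs \<in> partitions n. set xs \<subseteq> A \<inter> {..N}} = {xs \<in> partitions n. set xs \<subseteq> A}"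
    by auto
  then show ?thesis by (simp add: parts_gf_nth)
qed

text \<open>The list is decreasing, so \<open>M\<close> occurs iff it is the head; removing it leaves a partition of
  \<open>n - M\<close> of the same kind.\<close>

lemma parts_gf_insert:
  assumes "M > 0" and less: "\<And>a. a \<in> A \<Longrightarrow> a < M"
  shows "parts_gf (insert M A) * (1 - fps_X ^ M) = parts_gf A"
proof (rule fps_ext)
  fix n
  let ?S = "\<lambda>A n. {xs \<in> partitions n. set xs \<subseteq> A}"
  have split: "?S (insert M A) n = ?S A n \<union> (if M \<le> n then (#) M ` ?S (insert M A) (n - M) else {})"
    (is "_ = _ \<union> ?C")
  proof (intro equalityI subsetI)
    fix xs assume xs: "xs \<in> ?S (insert M A) n"
    show "xs \<in> ?S A n \<union> ?C"
    proof (cases "M \<in> set xs")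
      case True
      then obtain y ys where eq: "xs = y # ys" by (cases xs) auto
      have "y = M"
        using xs True less by (fastforce simp: eq partitions_def is_partition_def)
      then show ?thesis
        using xs by (auto simp: eq partitions_def is_partition_def)
    next
      case False
      then show ?thesis using xs by auto
    qed
  next
    fix xs assume "xs \<in> ?S A n \<union> ?C"
    then show "xs \<in> ?S (insert M A) n"
    proof
      assume "xs \<in> ?C"
      then obtain ys where "M \<le> n" "xs = M # ys" "ys \<in> ?S (insert M A) (n - M)"
        by (auto split: if_splits)
      then show ?thesis
        using less \<open>M > 0\<close> by (fastforce simp: partitions_def is_partition_def)
    qed auto
  qed
  have disj: "?S A n \<inter> ?C = {}" using less[of M] by (auto split: if_splits)
  have "card (?S (insert M A) n) = card (?S A n) + card ?C"
    unfolding split by (rule card_Un_disjoint) (use finite_partitions disj in auto)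
  moreover have "card ?C = (if M \<le> n then card (?S (insert M A) (n - M)) else 0)"
    by (simp add: card_image)
  ultimately show "fps_nth (parts_gf (insert M A) * (1 - fps_X ^ M)) n = fps_nth (parts_gf A) n"
    by (auto simp: algebra_simps fps_X_power_mult_nth parts_gf_nth)
qed

abbreviation part_factor :: "nat set \<Rightarrow> nat \<Rightarrow> rat fps" where
  "part_factor A m \<equiv> (if Suc m \<in> A then inverse (1 - fps_X ^ Suc m) else 1)"

lemma parts_gf_empty: "parts_gf (A \<inter> {..0}) = 1"
proof (rule fps_ext)
  fix n
  have "{xs \<in> partitions n. set xs \<subseteq> A \<inter> {..0}} = (if n = 0 then {[]} else {})"
  proof -
    have "xs = []" if "xs \<in> partitions n" "set xs \<subseteq> A \<inter> {..0}" for xs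
      using that by (cases xs) (auto simp: partitions_def is_partition_def)
    moreover have "[] \<in> partitions n \<longleftrightarrow> n = 0"
      by (auto simp: partitions_def is_partition_def)
    ultimately show ?thesis by auto
  qed
  then show "fps_nth (parts_gf (A \<inter> {..0})) n = fps_nth 1 n" by (simp add: parts_gf_nth)
qed

lemma prod_part_factor: "(\<Prod>m<N. part_factor A m) = parts_gf (A \<inter> {..N})"
proof (induction N)
  case 0
  show ?case by (simp add: parts_gf_empty[simplified])
next
  case (Suc N)
  show ?case
  proof (cases "Suc N \<in> A")
    case True
    let ?u = "1 - fps_X ^ Suc N :: rat fps"
    have unit: "?u * inverse ?u = 1"
      by (rule inverse_mult_eq_1') simp
    have "A \<inter> {..Suc N} = insert (Suc N) (A \<inter> {..N})" using True by auto
    then have "parts_gf (A \<inter> {..Suc N}) * ?u = parts_gf (A \<inter> {..N})"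
      by (simp only:) (rule parts_gf_insert; auto)
    then have "parts_gf (A \<inter> {..N}) * inverse ?u = parts_gf (A \<inter> {..Suc N}) * (?u * inverse ?u)"
      by (simp only: mult.assoc[symmetric])
    then show ?thesis using True Suc by (simp add: unit del: power_Suc)
  next
    case False
    then have "A \<inter> {..Suc N} = A \<inter> {..N}" by (auto simp: le_Suc_eq)
    then show ?thesis using False Suc by simp
  qed
qed

lemma parts_gf_nonzero: "parts_gf A \<noteq> 0"
proof -
  have "fps_nth (parts_gf A) 0 = 1"
    using parts_gf_cong_le[of 0 0 A] by (simp add: parts_gf_empty[simplified])
  then show ?thesis by auto
qed

lemma has_prod_parts_gf: "part_factor A has_prod parts_gf A"
proof -
  have "(\<lambda>N. \<Prod>m<N. part_factor A m) \<longlonglongrightarrow> parts_gf A"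
    unfolding prod_part_factor
  proof (rule tendsto_fpsI)
    fix n
    show "\<forall>\<^sub>F N in sequentially. fps_nth (parts_gf (A \<inter> {..N})) n = fps_nth (parts_gf A) n"
      using eventually_ge_at_top[of n] by eventually_elim (rule parts_gf_cong_le)
  qed
  then have "raw_has_prod (part_factor A) 0 (parts_gf A)"
    unfolding raw_has_prod_def add_0_right LIMSEQ_lessThan_iff_atMost using parts_gf_nonzero by blast
  then show ?thesis by (simp add: has_prod_def)
qed

text \<open>Read off from the finite products: up to degree \<open>n\<close> only parts at most \<open>n\<close> matter.\<close>

lemma parts_gf_Un:
  assumes "A \<inter> B = {}"
  shows "parts_gf (A \<union> B) = parts_gf A * parts_gf B"
proof (rule fps_ext)
  fix n
  have "fps_nth (parts_gf (A \<union> B)) n = fps_nth (parts_gf ((A \<union> B) \<inter> {..n})) n"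
    by (rule parts_gf_cong_le[symmetric]) simp
  also have "parts_gf ((A \<union> B) \<inter> {..n}) = (\<Prod>m<n. part_factor (A \<union> B) m)"
    by (rule prod_part_factor[symmetric])
  also have "\<dots> = (\<Prod>m<n. part_factor A m) * (\<Prod>m<n. part_factor B m)"
    unfolding prod.distrib[symmetric] by (rule prod.cong) (use assms in auto)
  also have "fps_nth \<dots> n = fps_nth (parts_gf A * parts_gf B) n"
    unfolding prod_part_factor
    by (simp add: fps_mult_nth parts_gf_cong_le)
  finally show "fps_nth (parts_gf (A \<union> B)) n = fps_nth (parts_gf A * parts_gf B) n" .
qed

section \<open>Decreasing lists of fixed length\<close>

text \<open>The entries may be zero, and the relation is also required between the last entry and a
  fictitious zero. Fixing the length allows sequences to be added entrywise although the
  partitions they stand for have different numbers of parts.\<close>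

definition chain_lists :: "(nat \<Rightarrow> nat \<Rightarrow> bool) \<Rightarrow> nat \<Rightarrow> nat list set" where
  "chain_lists R L = {xs. length xs = L \<and> successively R (xs @ [0])}"

lemma chain_lists_0: "chain_lists R 0 = {[]}"
  by (auto simp: chain_lists_def)

lemma Cons_in_chain_lists:
  "x # xs \<in> chain_lists R (Suc L) \<longleftrightarrow> R x (hd (xs @ [0])) \<and> xs \<in> chain_lists R L"
  by (auto simp: chain_lists_def successively_Cons)

lemma finite_chain_lists_weight:
  assumes "\<And>i. i \<le> w i"
  shows "finite {xs \<in> chain_lists R L. sum_list (map w xs) = n}"
proof (rule finite_subset)
  show "{xs \<in> chain_lists R L. sum_list (map w xs) = n} \<subseteq> {xs. set xs \<subseteq> {..n} \<and> length xs = L}"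
  proof safe
    fix xs x
    assume "x \<in> set xs" and "n = sum_list (map w xs)"
    then show "x \<le> sum_list (map w xs)"
      using member_le_sum_list[of "w x" "map w xs"] assms[of x] by auto
  qed (simp add: chain_lists_def)
qed (simp add: finite_lists_length_eq)

lemma decreasing_split_zeros:
  assumes "sorted_wrt (\<ge>) (xs :: nat list)"
  shows "filter (\<lambda>x. x > 0) xs @ replicate (length xs - length (filter (\<lambda>x. x > 0) xs)) 0 = xs"
  using assms
proof (induction xs)
  case (Cons x xs)
  show ?case
  proof (cases "x = 0")
    case True
    then have "\<forall>y\<in>set (x # xs). y = 0" using Cons.prems by simp
    then have "x # xs = replicate (length (x # xs)) 0"
      by (simp only: replicate_length_same)
    moreover have "filter (\<lambda>x. x > 0) (x # xs) = []"
      using \<open>\<forall>y\<in>set (x # xs). y = 0\<close> by (simp add: filter_empty_conv)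
    ultimately show ?thesis by simp
  next
    case False
    then show ?thesis using Cons by simp
  qed
qed simp

lemma successively_append_zeros:
  assumes "R 0 0"
  shows "successively R ((xs @ replicate m 0) @ [0]) \<longleftrightarrow> successively R (xs @ [0 :: nat])"
proof -
  have eq: "(xs @ replicate m 0) @ [0] = xs @ 0 # replicate m (0 :: nat)"
    by (simp add: replicate_append_same)
  have z: "successively R (0 # replicate m 0)"
    by (induction m) (use assms in auto)
  show ?thesis unfolding eq using z by (auto simp: successively_append_iff)
qed

lemma sum_list_filter_pos: "sum_list (filter (\<lambda>x. x > 0) xs) = sum_list (xs :: nat list)"
  by (induction xs) auto

lemma length_partition_le: "is_partition xs \<Longrightarrow> length xs \<le> sum_list xs"
  by (induction xs) (auto simp: is_partition_def)

lemma successively_ge_iff: "successively (\<ge>) xs \<longleftrightarrow> sorted_wrt (\<ge>) (xs :: nat list)"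
  by (rule successively_conv_sorted_wrt) (auto intro: transpI)

text \<open>A partition of \<open>n\<close> has at most \<open>n\<close> parts, so padding it with zeros to any length \<open>L \<ge> n\<close>
  loses nothing, and the relation survives the padding because it relates zero to itself.\<close>

lemma card_chain_lists_eq_partitions:
  assumes R0: "R 0 0" and dec: "\<And>x y. R x y \<Longrightarrow> y \<le> x" and "n \<le> L"
  shows "card {xs \<in> chain_lists R L. sum_list xs = n} =
    card {xs \<in> partitions n. successively R (xs @ [0])}"
proof -
  let ?pad = "\<lambda>xs. xs @ replicate (L - length xs) (0 :: nat)"
  let ?A = "{xs \<in> partitions n. successively R (xs @ [0])}"
  let ?B = "{xs \<in> chain_lists R L. sum_list xs = n}"
  have sorted: "sorted_wrt (\<ge>) xs" if "xs \<in> chain_lists R L" for xs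
  proof -
    have "successively (\<ge>) (xs @ [0])"
      using that dec by (auto simp: chain_lists_def elim: successively_mono)
    then show ?thesis
      by (simp add: successively_ge_iff sorted_wrt_append)
  qed
  have "bij_betw ?pad ?A ?B"
  proof (rule bij_betw_byWitness[where f' = "filter (\<lambda>x. x > 0)"])
    show "\<forall>xs\<in>?A. filter (\<lambda>x. x > 0) (?pad xs) = xs"
      by (auto simp: partitions_def is_partition_def)
    have pad_filter: "\<forall>xs\<in>?B. ?pad (filter (\<lambda>x. x > 0) xs) = xs"
    proof safe
      fix xs assume "xs \<in> chain_lists R L"
      then show "?pad (filter (\<lambda>x. x > 0) xs) = xs"
        using decreasing_split_zeros[OF sorted] by (simp add: chain_lists_def)
    qed
    from pad_filter show "\<forall>xs\<in>?B. ?pad (filter (\<lambda>x. x > 0) xs) = xs" .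
    show "?pad ` ?A \<subseteq> ?B"
    proof safe
      fix xs assume xs: "xs \<in> partitions n" and R: "successively R (xs @ [0])"
      have len: "length xs \<le> L" and sum: "sum_list xs = n"
        using xs length_partition_le[of xs] \<open>n \<le> L\<close> by (auto simp: partitions_def)
      show "?pad xs \<in> chain_lists R L"
        using len R successively_append_zeros[of R, OF R0] by (simp only: chain_lists_def mem_Collect_eq) simp
      show "sum_list (?pad xs) = n"
        by (simp add: sum sum_list_replicate)
    qed
    show "filter (\<lambda>x. x > 0) ` ?B \<subseteq> ?A"
    proof safe
      fix xs assume xs: "xs \<in> chain_lists R L" and n: "n = sum_list xs"
      show "filter (\<lambda>x. x > 0) xs \<in> partitions (sum_list xs)"
        using sorted[OF xs]
        by (simp add: partitions_def is_partition_def sorted_wrt_filter sum_list_filter_pos)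
      have "?pad (filter (\<lambda>x. x > 0) xs) = xs" using pad_filter xs n by blast
      then show "successively R (filter (\<lambda>x. x > 0) xs @ [0])"
        using xs successively_append_zeros[of R, OF R0] unfolding chain_lists_def
        by (metis (lifting) mem_Collect_eq)
    qed
  qed
  then show ?thesis by (simp add: bij_betw_same_card)
qed

section \<open>Splitting off multiples of a modulus\<close>

text \<open>A relation between adjacent indices of an enumeration, not between parts.\<close>

definition flat :: "nat \<Rightarrow> nat \<Rightarrow> bool" where
  "flat i j \<longleftrightarrow> j \<le> i \<and> i \<le> j + 2"

definition ge_in :: "nat set \<Rightarrow> nat \<Rightarrow> nat \<Rightarrow> bool" where
  "ge_in A x y \<longleftrightarrow> y \<le> x \<and> x \<in> A \<and> y \<in> A"

definition shift :: "(nat \<Rightarrow> nat) \<Rightarrow> nat list \<Rightarrow> nat list \<Rightarrow> nat list" where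
  "shift t is es = map2 (\<lambda>i e. t i + e) is es"

lemma shift_simps [simp]:
  "shift t [] [] = []"
  "shift t (i # is) (e # es) = (t i + e) # shift t is es"
  by (simp_all add: shift_def)

lemma hd_shift:
  assumes "t 0 = 0" and "length is = length es"
  shows "hd (shift t is es @ [0]) = t (hd (is @ [0])) + hd (es @ [0])"
  using assms by (cases "is"; cases es) auto

lemma sum_list_shift:
  "length is = length es \<Longrightarrow> sum_list (shift t is es) = sum_list (map t is) + sum_list es"
  by (induction "is" es rule: list_induct2) auto

lemma hd_chain_in:
  "es \<in> chain_lists (ge_in A) L \<Longrightarrow> 0 \<in> A \<Longrightarrow> hd (es @ [0]) \<in> A"
  by (cases es; cases L) (auto simp: Cons_in_chain_lists ge_in_def chain_lists_def successively_Cons)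

text \<open>Adding \<open>t\<close> of a flat index list to a decreasing list of multiples of \<open>m\<close> can be undone from the
  end of the lists backwards. The entry of the sum modulo \<open>m\<close> is that of \<open>t\<close> at the unknown index,
  and flatness leaves only three candidates for this index once the next one is known; these are
  told apart by assumption \<open>residue\<close>. The fictitious zero starts the recursion because \<open>t 0 = 0\<close>.\<close>

lemma bij_betw_shift:
  fixes t :: "nat \<Rightarrow> nat"
  assumes t0: "t 0 = 0"
    and closed: "\<And>i j e f. flat i j \<Longrightarrow> ge_in {x. m dvd x} e f \<Longrightarrow> R (t i + e) (t j + f)"
    and split: "\<And>x j f. m dvd f \<Longrightarrow> R x (t j + f) \<Longrightarrow>
        \<exists>i e. flat i j \<and> ge_in {x. m dvd x} e f \<and> x = t i + e"
    and residue: "\<And>i i' j. flat i j \<Longrightarrow> flat i' j \<Longrightarrow> t i mod m = t i' mod m \<Longrightarrow> i = i'"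
  shows "bij_betw (\<lambda>(is, es). shift t is es)
    (chain_lists flat L \<times> chain_lists (ge_in {x. m dvd x}) L) (chain_lists R L)"
proof -
  let ?E = "chain_lists (ge_in {x. m dvd x})"
  have image: "shift t is es \<in> chain_lists R L" if "is \<in> chain_lists flat L" "es \<in> ?E L" for "is" es L
    using that
  proof (induction L arbitrary: "is" es)
    case (Suc L)
    from Suc.prems obtain i is' e es' where eq: "is = i # is'" "es = e # es'"
      by (auto simp: chain_lists_def length_Suc_conv)
    have len: "length is' = length es'" using Suc.prems by (simp add: eq chain_lists_def)
    show ?case
      using Suc closed len by (simp add: eq Cons_in_chain_lists hd_shift[where t = t, OF t0 len] del: hd_append2)
  qed (simp add: chain_lists_0)
  have surj: "\<exists>is\<in>chain_lists flat L. \<exists>es\<in>?E L. xs = shift t is es" if "xs \<in> chain_lists R L" for xs L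
    using that
  proof (induction L arbitrary: xs)
    case (Suc L)
    from Suc.prems obtain x xs' where xs: "xs = x # xs'"
      by (auto simp: chain_lists_def length_Suc_conv)
    have x: "R x (hd (xs' @ [0]))" and "xs' \<in> chain_lists R L"
      using Suc.prems by (simp_all add: xs Cons_in_chain_lists)
    then obtain is' es' where tl: "is' \<in> chain_lists flat L" "es' \<in> ?E L" "xs' = shift t is' es'"
      using Suc.IH by blast
    have len: "length is' = length es'" using tl by (simp add: chain_lists_def)
    obtain i e where "flat i (hd (is' @ [0]))" "ge_in {x. m dvd x} e (hd (es' @ [0]))" "x = t i + e"
      using x split hd_chain_in[OF tl(2)] unfolding tl(3) hd_shift[where t = t, OF t0 len] by fastforce
    with tl have "i # is' \<in> chain_lists flat (Suc L)" "e # es' \<in> ?E (Suc L)"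
        "xs = shift t (i # is') (e # es')"
      by (simp_all add: xs Cons_in_chain_lists)
    then show ?case by blast
  qed (simp add: chain_lists_0)
  have inj: "is = is' \<and> es = es'"
    if "is \<in> chain_lists flat L" "es \<in> ?E L" "is' \<in> chain_lists flat L" "es' \<in> ?E L"
      "shift t is es = shift t is' es'" for "is" es is' es' L
    using that
  proof (induction L arbitrary: "is" es is' es')
    case (Suc L)
    from Suc.prems obtain i js e fs i' js' e' fs'
      where eq: "is = i # js" "es = e # fs" "is' = i' # js'" "es' = e' # fs'"
      by (auto simp: chain_lists_def length_Suc_conv)
    have tl: "js = js' \<and> fs = fs'"
      by (rule Suc.IH) (use Suc.prems in \<open>simp_all add: eq Cons_in_chain_lists\<close>)
    have "flat i (hd (js @ [0]))" "flat i' (hd (js @ [0]))" "m dvd e" "m dvd e'"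
      using Suc.prems tl by (simp_all add: eq Cons_in_chain_lists ge_in_def)
    moreover have sum: "t i + e = t i' + e'" using Suc.prems by (simp add: eq)
    moreover have "t i mod m = t i' mod m"
      using \<open>m dvd e\<close> \<open>m dvd e'\<close> sum by (metis mod_add_right_eq dvd_imp_mod_0 add.right_neutral)
    ultimately have "i = i'" using residue by blast
    with tl sum show ?case by (simp add: eq)
  qed (simp add: chain_lists_0)
  show ?thesis
    unfolding bij_betw_def
  proof
    show "inj_on (\<lambda>(is, es). shift t is es) (chain_lists flat L \<times> ?E L)"
      using inj by (fastforce intro!: inj_onI)
    show "(\<lambda>(is, es). shift t is es) ` (chain_lists flat L \<times> ?E L) = chain_lists R L"
      using image surj by fastforce
  qed
qed

text \<open>The bound \<open>i \<le> t i\<close> serves to make the number of flat index lists of given weight finite.\<close>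

lemma gf_chain_lists_factor:
  fixes t :: "nat \<Rightarrow> nat"
  assumes "t 0 = 0" and "\<And>i. i \<le> t i"
    and "\<And>i j e f. flat i j \<Longrightarrow> ge_in {x. m dvd x} e f \<Longrightarrow> R (t i + e) (t j + f)"
    and "\<And>x j f. m dvd f \<Longrightarrow> R x (t j + f) \<Longrightarrow>
        \<exists>i e. flat i j \<and> ge_in {x. m dvd x} e f \<and> x = t i + e"
    and "\<And>i i' j. flat i j \<Longrightarrow> flat i' j \<Longrightarrow> t i mod m = t i' mod m \<Longrightarrow> i = i'"
  shows "gf (chain_lists R L) sum_list =
    gf (chain_lists flat L) (\<lambda>is. sum_list (map t is)) * gf (chain_lists (ge_in {x. m dvd x}) L) sum_list"
proof -
  let ?F = "chain_lists flat L" and ?E = "chain_lists (ge_in {x. m dvd x}) L"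
  have "gf (chain_lists R L) sum_list = gf (?F \<times> ?E) (\<lambda>(is, es). sum_list (map t is) + sum_list es)"
    by (rule gf_bij_betw[OF bij_betw_shift[where t = t and m = m]])
      (use assms in \<open>auto simp: chain_lists_def sum_list_shift\<close>)
  also have "\<dots> = gf ?F (\<lambda>is. sum_list (map t is)) * gf ?E sum_list"
    by (rule gf_times) (use finite_chain_lists_weight[of t] finite_chain_lists_weight[of "\<lambda>x. x"] assms(2) in simp_all)
  finally show ?thesis .
qed

section \<open>The difference conditions as a relation between adjacent parts\<close>

lemma mod_3_cases:
  fixes j :: nat
  obtains "j mod 3 = 0" | "j mod 3 = 1" | "j mod 3 = 2"
proof -
  have "j mod 3 = 0 \<or> j mod 3 = 1 \<or> j mod 3 = 2" by presburger
  then show ?thesis by (elim disjE) (fact that)+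
qed

lemma double_mod_3:
  fixes j :: nat
  shows "2 * j mod 3 = 1 \<longleftrightarrow> j mod 3 = 2" and "2 * j mod 3 = 2 \<longleftrightarrow> j mod 3 = 1"
  by presburger+

lemma ex_residue_3:
  fixes x y a :: nat
  assumes "y \<le> x" "a \<le> x - y" "(x - y) mod 3 = a mod 3"
  shows "\<exists>w. x = y + a + 3 * w"
proof -
  have "3 dvd (x - y) - a"
    using assms(2,3) by (metis mod_eq_dvd_iff_nat)
  then obtain w where "(x - y) - a = 3 * w" by blast
  then show ?thesis using assms(1,2) by (intro exI[of _ w]) linarith
qed

text \<open>The difference conditions for a part \<open>x\<close> followed by \<open>y\<close>; unlike those, the relation also
  requires the list to be decreasing, so that the subtraction is never truncated.\<close>

definition S_rel :: "nat \<Rightarrow> nat \<Rightarrow> nat \<Rightarrow> bool" where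
  "S_rel k x y \<longleftrightarrow> y \<le> x \<and> x - y \<noteq> 1 \<and>
     (x - y \<in> prog2 k \<longrightarrow> \<not> [y = 2] (mod 3)) \<and> (x - y \<in> prog4 k \<longrightarrow> [y = 1] (mod 3))"

lemma prog2_iff: "d \<in> prog2 k \<longleftrightarrow> d mod 3 = 2 \<and> d + 4 \<le> 3 * k"
  unfolding prog2_def mem_Collect_eq by presburger

lemma prog4_iff: "d \<in> prog4 k \<longleftrightarrow> d mod 3 = 1 \<and> d \<noteq> 1 \<and> d + 2 \<le> 3 * k"
  unfolding prog4_def mem_Collect_eq by presburger

lemma prog1_iff: "d \<in> prog1 k \<longleftrightarrow> d mod 3 = 1 \<and> d + 2 \<le> 3 * k"
  unfolding prog1_def mem_Collect_eq by presburger

text \<open>The two progressions exclude all differences of a given residue below a bound, so the conditions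
  only prescribe a least difference for each pair of residues.\<close>

lemma S_rel_iff:
  assumes "k \<ge> 1"
  shows "S_rel k x y \<longleftrightarrow> y \<le> x \<and>
    ((x - y) mod 3 = 1 \<longrightarrow> (if y mod 3 = 1 then 4 else 3 * k + 1) \<le> x - y) \<and>
    ((x - y) mod 3 = 2 \<and> y mod 3 = 2 \<longrightarrow> 3 * k - 1 \<le> x - y)"
proof -
  define d where "d = x - y"
  have c: "[y = 2] (mod 3) \<longleftrightarrow> y mod 3 = 2" "[y = 1] (mod 3) \<longleftrightarrow> y mod 3 = 1"
    by (simp_all add: cong_def)
  note unfold = S_rel_def prog2_iff prog4_iff c d_def[symmetric]
  show ?thesis
  proof (cases rule: mod_3_cases[of d])
    case 1
    then have "d \<noteq> 1" by auto
    with 1 show ?thesis unfolding unfold by simp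
  next
    case 2
    then have "d \<noteq> 1 \<longleftrightarrow> 4 \<le> d" "d + 2 \<le> 3 * k \<longleftrightarrow> \<not> 3 * k + 1 \<le> d"
      by presburger+
    moreover have "3 * k + 1 \<le> d \<Longrightarrow> 4 \<le> d" using assms by linarith
    ultimately show ?thesis unfolding unfold 2 by (cases "y mod 3 = 1") auto
  next
    case 3
    then have "d \<noteq> 1" by auto
    moreover have "d + 4 \<le> 3 * k \<longleftrightarrow> \<not> 3 * k - 1 \<le> d" using 3 by presburger
    ultimately show ?thesis unfolding unfold 3 by (cases "y mod 3 = 2") auto
  qed
qed

lemma difference_conditions_iff:
  assumes "sorted_wrt (\<ge>) xs"
  shows "difference_conditions k xs \<longleftrightarrow> successively (S_rel k) xs"
proof -
  have "xs ! Suc i \<le> xs ! i" if "Suc i < length xs" for i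
    using assms that by (simp add: sorted_wrt_iff_nth_less)
  then show ?thesis
    by (auto simp: difference_conditions_def successively_conv_nth S_rel_def)
qed

lemma sorted_append_0: "is_partition xs \<Longrightarrow> sorted_wrt (\<ge>) (xs @ [0])"
  by (simp add: is_partition_def sorted_wrt_append)

text \<open>This is why the fictitious zero bars every part from \<open>1, 4, \<dots>, 3 * k - 2\<close> and not only the last
  one: climbing from zero, residue 1 can only be entered by a difference of at least \<open>3 * k + 1\<close> from
  residue 0, or of at least \<open>3 * k - 1\<close> from residue 2, where the smaller part is at least 2; in
  either case the larger part is at least \<open>3 * k + 1\<close>, and so are all later ones.\<close>

lemma S_chain_mod_1:
  assumes "k \<ge> 1" and "successively (S_rel k) (xs @ [0])" and "x \<in> set xs" and "x mod 3 = 1"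
  shows "3 * k + 1 \<le> x"
  using assms(2-)
proof (induction xs arbitrary: x)
  case (Cons z xs)
  define y where "y = hd (xs @ [0])"
  have z: "S_rel k z y" and tl: "successively (S_rel k) (xs @ [0])"
    using Cons.prems by (auto simp: successively_Cons y_def)
  show ?case
  proof (cases "x \<in> set xs")
    case True
    then show ?thesis using Cons.IH tl Cons.prems by blast
  next
    case False
    then have "x = z" using Cons.prems by simp
    have y: "y mod 3 = 1 \<Longrightarrow> 3 * k + 1 \<le> y"
      using Cons.IH[OF tl, of y] by (cases xs) (auto simp: y_def)
    have "y \<le> z" using z by (simp add: S_rel_def)
    then have "(y mod 3 + (z - y) mod 3) mod 3 = 1"
      using Cons.prems(3) unfolding \<open>x = z\<close> mod_add_eq by simp
    then consider "y mod 3 = 0" "(z - y) mod 3 = 1" | "y mod 3 = 1"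
      | "y mod 3 = 2" "(z - y) mod 3 = 2"
      by (cases rule: mod_3_cases[of y]; cases rule: mod_3_cases[of "z - y"]) auto
    then show ?thesis
    proof cases
      case 1
      then have "3 * k + 1 \<le> z - y" using z unfolding S_rel_iff[OF assms(1)] by simp
      then show ?thesis unfolding \<open>x = z\<close> by linarith
    next
      case 2
      then show ?thesis using y \<open>y \<le> z\<close> unfolding \<open>x = z\<close> by linarith
    next
      case 3
      then have "3 * k - 1 \<le> z - y" using z unfolding S_rel_iff[OF assms(1)] by simp
      moreover have "2 \<le> y" using 3(1) mod_less_eq_dividend[of y 3] by linarith
      ultimately show ?thesis using \<open>y \<le> z\<close> unfolding \<open>x = z\<close> by linarith
    qed
  qed
qed simp

lemma cond_S_iff_successively:
  assumes "k \<ge> 1" and "is_partition xs"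
  shows "cond_S k xs \<longleftrightarrow> successively (S_rel k) (xs @ [0])"
proof
  assume S: "cond_S k xs"
  then have "successively (S_rel k) xs"
    using assms difference_conditions_iff by (simp add: cond_S_def is_partition_def)
  moreover have "S_rel k (last xs) 0" if "xs \<noteq> []"
  proof -
    have "last xs \<notin> prog1 k" using S that by (simp add: cond_S_def)
    then have "last xs mod 3 = 1 \<Longrightarrow> 3 * k + 1 \<le> last xs"
      unfolding prog1_iff by presburger
    then show ?thesis unfolding S_rel_iff[OF assms(1)] by simp
  qed
  ultimately show "successively (S_rel k) (xs @ [0])"
    by (auto simp: successively_append_iff)
next
  assume chain: "successively (S_rel k) (xs @ [0])"
  then have "successively (S_rel k) xs" by (simp add: successively_append_iff)
  moreover have "x \<notin> prog1 k" if "x \<in> set xs" for x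
    using S_chain_mod_1[OF assms(1) chain that] by (auto simp: prog1_iff)
  ultimately show "cond_S k xs"
    using assms difference_conditions_iff by (simp add: cond_S_def is_partition_def)
qed

section \<open>The numbers congruent to 0, 2 or -2\<close>

text \<open>The enumeration \<open>0, 2, Q - 2, Q, Q + 2, \<dots>\<close> with \<open>Q = 3 * k + 3\<close>: its increments
  \<open>2, 3 * k - 1, 2\<close> recur with period 3 and add up to \<open>Q\<close>.\<close>

primrec site :: "nat \<Rightarrow> nat \<Rightarrow> nat" where
  "site k 0 = 0"
| "site k (Suc i) = site k i + (if i mod 3 = 1 then 3 * k - 1 else 2)"

lemma site_add_2:
  "k \<ge> 1 \<Longrightarrow> site k (j + 2) = site k j + (if j mod 3 = 2 then 4 else 3 * k + 1)"
  unfolding add_2_eq_Suc'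
  by (cases rule: mod_3_cases[of j]) (simp_all add: mod_Suc)

lemma site_add_3:
  assumes "k \<ge> 1"
  shows "site k (j + 3) = site k j + (3 * k + 3)"
proof -
  have "j + 3 = Suc (Suc (Suc j))" by simp
  then show ?thesis
    using assms by (simp only:, cases rule: mod_3_cases[of j]) (simp_all add: mod_Suc)
qed

text \<open>All increments are congruent to 2 modulo 3.\<close>

lemma site_mod_3:
  assumes "k \<ge> 1"
  shows "site k i mod 3 = 2 * i mod 3"
proof (induction i)
  case (Suc i)
  define step where "step = (if i mod 3 = 1 then 3 * k - 1 else 2)"
  have "step = 2 \<or> step = 2 + 3 * (k - 1)" using assms by (auto simp: step_def)
  then have "step mod 3 = 2" by (elim disjE) (simp_all only: mod_mult_self2, simp_all)
  have "site k (Suc i) mod 3 = (site k i mod 3 + step mod 3) mod 3"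
    by (simp only: site.simps step_def mod_add_eq)
  also have "\<dots> = (2 * i mod 3 + 2 mod 3) mod 3"
    by (simp only: Suc.IH \<open>step mod 3 = 2\<close>) simp
  also have "\<dots> = (2 * Suc i) mod 3"
    by (simp only: mod_add_eq) simp
  finally show ?case .
qed simp

lemma le_site: "k \<ge> 1 \<Longrightarrow> i \<le> site k i"
  by (induction i) auto

lemma strict_mono_site: "k \<ge> 1 \<Longrightarrow> strict_mono (site k)"
  by (rule strict_monoI_Suc) auto

lemma site_add_period: "k \<ge> 1 \<Longrightarrow> site k (j + 3 * v) = site k j + (3 * k + 3) * v"
proof (induction v)
  case (Suc v)
  have "j + 3 * Suc v = (j + 3 * v) + 3" by simp
  then show ?case using Suc site_add_3[of k "j + 3 * v"] by (simp only:) simp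
qed simp

lemma range_site:
  assumes "k \<ge> 1"
  shows "range (site k) = {x. (3 * k + 3) dvd x} \<union> {x. x mod (3 * k + 3) \<in> {2, 3 * k + 1}}"
    (is "_ = ?D \<union> ?R")
proof -
  have "site k 2 = 3 * k + 1" using site_add_2[OF assms, of 0] by (simp only: add_0) simp
  then have base: "site k 0 = 0" "site k 1 = 2" "site k 2 = 3 * k + 1" by simp_all
  have "x \<in> ?D \<union> ?R" if "x \<in> range (site k)" for x
  proof -
    from that obtain i where "x = site k i" by blast
    then have x: "x = site k (i mod 3) + (3 * k + 3) * (i div 3)"
      using site_add_period[OF assms, of "i mod 3" "i div 3"] by simp
    have "site k (i mod 3) \<in> {0, 2, 3 * k + 1}"
      using base by (cases rule: mod_3_cases[of i]) auto
    moreover have "x mod (3 * k + 3) = site k (i mod 3) mod (3 * k + 3)"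
      unfolding x by (rule mod_mult_self2)
    ultimately have "x mod (3 * k + 3) \<in> {0, 2, 3 * k + 1}" using assms by auto
    then show ?thesis by (auto simp: dvd_eq_mod_eq_0)
  qed
  moreover have "x \<in> range (site k)" if "x \<in> ?D \<union> ?R" for x
  proof -
    have "x mod (3 * k + 3) \<in> {site k 0, site k 1, site k 2}"
      using that unfolding base by (auto simp: dvd_eq_mod_eq_0)
    then obtain r where r: "x mod (3 * k + 3) = site k r" by blast
    have "x = x mod (3 * k + 3) + (3 * k + 3) * (x div (3 * k + 3))" by simp
    also have "\<dots> = site k (r + 3 * (x div (3 * k + 3)))"
      unfolding r site_add_period[OF assms] ..
    finally show ?thesis by blast
  qed
  ultimately show ?thesis by blast
qed

section \<open>The two factorizations\<close>

lemma flat_cases: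
  assumes "flat i j"
  obtains "i = j" | "i = j + 1" | "i = j + 2"
  using assms unfolding flat_def by linarith

lemma flat_residue:
  assumes "k \<ge> 1" "3 dvd m" and "flat i j" "flat i' j" "site k i mod m = site k i' mod m"
  shows "i = i'"
proof -
  have close: "a = b" if "a \<le> b" "b \<le> a + 2" "a mod 3 = b mod 3" for a b :: nat
  proof -
    have "3 dvd b - a"
      using that mod_eq_dvd_iff_nat[of a b 3] by simp
    then show ?thesis
      using that dvd_imp_le[of 3 "b - a"] by linarith
  qed
  have "site k i mod 3 = site k i' mod 3"
    using assms by (metis mod_mod_cancel)
  then have "2 * i mod 3 = 2 * i' mod 3"
    using assms(1) by (simp add: site_mod_3)
  then have "i mod 3 = i' mod 3"
    using double_mod_3[of i] double_mod_3[of i']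
    by (cases rule: mod_3_cases[of i]; cases rule: mod_3_cases[of i']) simp_all
  then show ?thesis
    using assms(3,4) close[of i i'] close[of i' i] unfolding flat_def by linarith
qed

lemma S_rel_add_iff:
  assumes "k \<ge> 1"
  shows "S_rel k (y + d) y \<longleftrightarrow>
    (d mod 3 = 1 \<longrightarrow> (if y mod 3 = 1 then 4 else 3 * k + 1) \<le> d) \<and>
    (d mod 3 = 2 \<and> y mod 3 = 2 \<longrightarrow> 3 * k - 1 \<le> d)"
  by (simp add: S_rel_iff[OF assms])

lemma gap_mod_3:
  fixes k :: nat
  assumes "k \<ge> 1"
  shows "(3 * k - 1) mod 3 = 2"
proof -
  have "3 * k - 1 = 2 + 3 * (k - 1)" using assms by simp
  then show ?thesis by (simp only: mod_mult_self2) simp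
qed

text \<open>Going from index \<open>j\<close> to \<open>j\<close>, \<open>j + 1\<close>, \<open>j + 2\<close> raises \<open>site k\<close> by a number congruent to 0, 2, 1
  modulo 3, and this number is the least difference that the relation allows in this residue class.\<close>

lemma S_factor:
  assumes "k \<ge> 1"
  shows "gf (chain_lists (S_rel k) L) sum_list =
    gf (chain_lists flat L) (\<lambda>is. sum_list (map (site k) is)) *
    gf (chain_lists (ge_in {x. 3 dvd x}) L) sum_list"
proof (rule gf_chain_lists_factor)
  have mod: "(site k j + f) mod 3 = 2 * j mod 3" if "3 dvd f" for j f
    using site_mod_3[OF assms, of j] that by (metis dvd_imp_mod_0 mod_add_right_eq add_0_right)
  show "S_rel k (site k i + e) (site k j + f)"
    if ij: "flat i j" and ef: "ge_in {x. 3 dvd x} e f" for i j e f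
  proof -
    obtain w where w: "e = f + 3 * w" and f: "3 dvd f"
      using ef unfolding ge_in_def by (metis dvd_diff_nat dvdE le_add_diff_inverse mem_Collect_eq)
    define y where "y = site k j + f"
    have y: "y mod 3 = 2 * j mod 3" using mod[OF f] by (simp add: y_def)
    from ij show ?thesis
    proof (cases rule: flat_cases)
      case 1
      then have "site k i + e = y + 3 * w" by (simp add: w y_def)
      then show ?thesis unfolding y_def[symmetric] by (simp add: S_rel_add_iff[OF assms])
    next
      case 2
      define a where "a = (if j mod 3 = 1 then 3 * k - 1 else 2)"
      have "a mod 3 = 2" using gap_mod_3[OF assms] by (simp add: a_def)
      then have "(3 * w + a) mod 3 = 2" by simp
      moreover have "site k i + e = y + (3 * w + a)" by (simp add: 2 w y_def a_def)
      moreover have "y mod 3 = 2 \<longleftrightarrow> j mod 3 = 1" unfolding y double_mod_3 ..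
      ultimately show ?thesis
        unfolding y_def[symmetric] by (simp add: S_rel_add_iff[OF assms]) (simp add: a_def)
    next
      case 3
      define a where "a = (if j mod 3 = 2 then 4 else 3 * k + 1)"
      have "a mod 3 = 1" by (simp add: a_def)
      then have "(3 * w + a) mod 3 = 1" by simp
      moreover have "site k i + e = y + (3 * w + a)"
        unfolding 3 site_add_2[OF assms] by (simp add: w y_def a_def)
      moreover have "y mod 3 = 1 \<longleftrightarrow> j mod 3 = 2" unfolding y double_mod_3 ..
      ultimately show ?thesis
        unfolding y_def[symmetric] by (simp add: S_rel_add_iff[OF assms]) (simp add: a_def)
    qed
  qed
  show "\<exists>i e. flat i j \<and> ge_in {x. 3 dvd x} e f \<and> x = site k i + e"
    if f: "3 dvd f" and x: "S_rel k x (site k j + f)" for x j f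
  proof -
    define y where "y = site k j + f"
    have y: "y mod 3 = 2 * j mod 3" using mod[OF f] by (simp add: y_def)
    have le: "y \<le> x" using x by (simp add: S_rel_def y_def)
    have "\<exists>i. flat i j \<and> (\<exists>w. x = site k i + f + 3 * w)"
    proof (cases rule: mod_3_cases[of "x - y"])
      case 1
      then have "\<exists>w. x = y + 0 + 3 * w" using le by (intro ex_residue_3) simp_all
      then show ?thesis by (intro exI[of _ j]) (simp add: flat_def y_def)
    next
      case 3
      \<comment> \<open>the increment of the enumeration over one index, of residue 2\<close>
      define a where "a = (if j mod 3 = 1 then 3 * k - 1 else 2)"
      have "y mod 3 = 2 \<longleftrightarrow> j mod 3 = 1" unfolding y double_mod_3 ..
      then have "a \<le> x - y"
        using x 3 mod_less_eq_dividend[of "x - y" 3]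
        unfolding y_def[symmetric] S_rel_iff[OF assms] a_def by simp
      moreover have "a mod 3 = 2" using gap_mod_3[OF assms] by (simp add: a_def)
      ultimately have "\<exists>w. x = y + a + 3 * w" using 3 le by (intro ex_residue_3) simp_all
      then show ?thesis
        by (intro exI[of _ "j + 1"]) (simp add: flat_def y_def a_def add_ac)
    next
      case 2
      \<comment> \<open>the increment over two indices, of residue 1\<close>
      define a where "a = (if j mod 3 = 2 then 4 else 3 * k + 1)"
      have "y mod 3 = 1 \<longleftrightarrow> j mod 3 = 2" unfolding y double_mod_3 ..
      then have "a \<le> x - y"
        using x 2 unfolding y_def[symmetric] S_rel_iff[OF assms] a_def by simp
      moreover have "a mod 3 = 1" by (simp add: a_def)
      ultimately have "\<exists>w. x = y + a + 3 * w" using 2 le by (intro ex_residue_3) simp_all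
      then show ?thesis unfolding y_def
        by (intro exI[of _ "j + 2"]) (simp only: site_add_2[OF assms] flat_def a_def, simp add: add_ac)
    qed
    then obtain i w where "flat i j" "x = site k i + (f + 3 * w)" by (auto simp: add.assoc)
    then show ?thesis using f by (fastforce simp: ge_in_def)
  qed
qed (use assms le_site flat_residue[of k 3] in auto)

text \<open>Here the index of a part determines everything: divide the excess of its index over that of the
  next part by 3; the remainder is a flat step and each unit of the quotient contributes
  \<open>3 * k + 3\<close>.\<close>

lemma site_parts_factor:
  assumes "k \<ge> 1"
  shows "gf (chain_lists (ge_in (range (site k))) L) sum_list =
    gf (chain_lists flat L) (\<lambda>is. sum_list (map (site k) is)) *
    gf (chain_lists (ge_in {x. (3 * k + 3) dvd x}) L) sum_list"
proof (rule gf_chain_lists_factor)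
  let ?Q = "3 * k + 3"
  note le_iff = strict_mono_less_eq[OF strict_mono_site[OF assms]]
  show "ge_in (range (site k)) (site k i + e) (site k j + f)"
    if ij: "flat i j" and ef: "ge_in {x. ?Q dvd x} e f" for i j e f
  proof -
    obtain v w where vw: "f = ?Q * v" "e = ?Q * w" and "f \<le> e"
      using ef by (auto simp: ge_in_def elim!: dvdE)
    have "site k i + e = site k (i + 3 * w)" "site k j + f = site k (j + 3 * v)"
      unfolding vw site_add_period[OF assms] by simp_all
    then have "site k i + e \<in> range (site k)" "site k j + f \<in> range (site k)" by simp_all
    moreover have "site k j \<le> site k i"
      using ij by (simp add: le_iff flat_def)
    ultimately show ?thesis
      using \<open>f \<le> e\<close> by (simp add: ge_in_def add_mono)
  qed
  show "\<exists>i e. flat i j \<and> ge_in {x. ?Q dvd x} e f \<and> x = site k i + e"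
    if f_dvd: "?Q dvd f" and x_in: "ge_in (range (site k)) x (site k j + f)" for x j f
  proof -
    obtain v where f: "f = ?Q * v" using f_dvd by blast
    obtain i where x: "x = site k i" using x_in by (auto simp: ge_in_def)
    have "site k (j + 3 * v) \<le> site k i"
      using x_in unfolding site_add_period[OF assms] by (simp add: ge_in_def f x)
    then have le: "j + 3 * v \<le> i" by (simp only: le_iff)
    define r w where "r = (i - (j + 3 * v)) mod 3" and "w = (i - (j + 3 * v)) div 3"
    have rw: "r + 3 * w = i - (j + 3 * v)" unfolding r_def w_def by (rule mod_mult_div_eq)
    have "i = (j + r) + 3 * (v + w)"
      using le_add_diff_inverse[OF le] unfolding rw[symmetric] by (simp add: algebra_simps)
    then have "x = site k (j + r) + ?Q * (v + w)"
      unfolding x by (simp only: site_add_period[OF assms])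
    moreover have "r < 3" by (simp add: r_def)
    then have "flat (j + r) j" by (simp add: flat_def)
    moreover have "ge_in {x. ?Q dvd x} (?Q * (v + w)) f"
      using mult_le_mono2[of v "v + w" ?Q]
      unfolding ge_in_def f mem_Collect_eq by (simp only: dvd_triv_left le_add1 simp_thms)
    ultimately show ?thesis by blast
  qed
  have "3 dvd ?Q" by presburger
  then show "i = i'" if "flat i j" "flat i' j" "site k i mod ?Q = site k i' mod ?Q" for i i' j
    using flat_residue[OF assms _ that] by blast
qed (use assms le_site in auto)

section \<open>Comparing the generating functions\<close>

lemma fps_nth_chain_lists_parts:
  assumes "0 \<in> A" "n \<le> L"
  shows "fps_nth (gf (chain_lists (ge_in A) L) sum_list) n = fps_nth (parts_gf A) n"
proof -
  have "successively (ge_in A) (xs @ [0]) \<longleftrightarrow> set xs \<subseteq> A" if "is_partition xs" for xs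
    using sorted_append_0[OF that]
    by (induction xs) (use assms(1) in \<open>auto simp: successively_Cons ge_in_def hd_append dest: hd_in_set\<close>)
  then have "{xs \<in> partitions n. successively (ge_in A) (xs @ [0])} = {xs \<in> partitions n. set xs \<subseteq> A}"
    by (auto simp: partitions_def)
  moreover have "card {xs \<in> chain_lists (ge_in A) L. sum_list xs = n} =
      card {xs \<in> partitions n. successively (ge_in A) (xs @ [0])}"
    by (rule card_chain_lists_eq_partitions) (use assms in \<open>simp_all add: ge_in_def\<close>)
  ultimately show ?thesis by (simp add: gf_nth parts_gf_nth)
qed

lemma fps_nth_chain_lists_S:
  assumes "k \<ge> 1" "n \<le> L"
  shows "fps_nth (gf (chain_lists (S_rel k) L) sum_list) n = of_nat (card {xs \<in> partitions n. cond_S k xs})"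
proof -
  have "{xs \<in> partitions n. successively (S_rel k) (xs @ [0])} = {xs \<in> partitions n. cond_S k xs}"
    using cond_S_iff_successively[OF assms(1)] by (auto simp: partitions_def)
  moreover have "card {xs \<in> chain_lists (S_rel k) L. sum_list xs = n} =
      card {xs \<in> partitions n. successively (S_rel k) (xs @ [0])}"
    by (rule card_chain_lists_eq_partitions) (use assms in \<open>simp_all add: S_rel_iff\<close>)
  ultimately show ?thesis by (simp add: gf_nth)
qed

lemma admissible_part_iff:
  assumes "k \<ge> 1"
  shows "admissible_part k m \<longleftrightarrow> 3 dvd m \<or> m mod (3 * k + 3) \<in> {2, 3 * k + 1}"
proof -
  have Q: "3 * int k + 3 = int (3 * k + 3)" by simp
  have "- 2 - int (3 * k + 1) = - (3 * int k + 3)" by simp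
  then have "[- 2 = int (3 * k + 1)] (mod (3 * int k + 3))"
    by (simp only: cong_iff_dvd_diff dvd_minus_iff dvd_refl)
  then have "[int m = - 2] (mod (3 * int k + 3)) \<longleftrightarrow> [int m = int (3 * k + 1)] (mod int (3 * k + 3))"
    unfolding Q using cong_sym cong_trans by blast
  also have "\<dots> \<longleftrightarrow> m mod (3 * k + 3) = 3 * k + 1"
    unfolding cong_int_iff by (simp add: cong_def)
  finally have minus: "[int m = - 2] (mod (3 * int k + 3)) \<longleftrightarrow> m mod (3 * k + 3) = 3 * k + 1" .
  have "[int m = 2] (mod (3 * int k + 3)) \<longleftrightarrow> [int m = int 2] (mod int (3 * k + 3))"
    unfolding Q by simp
  also have "\<dots> \<longleftrightarrow> m mod (3 * k + 3) = 2"
    unfolding cong_int_iff using assms by (simp add: cong_def)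
  finally show ?thesis using minus by (auto simp: admissible_part_def)
qed

lemma gf_P_eq: "gf_P k = parts_gf {m. admissible_part k m}"
  by (simp add: gf_P_def parts_gf_def cond_P_def subset_eq)

text \<open>Multiplying by the generating function of the multiples of \<open>3 * k + 3\<close> turns both sides into
  the product of that of the flat lists with those of the multiples of 3 and of \<open>3 * k + 3\<close>. Since
  lists of fixed length only give the coefficients up to that length, the comparison is made in
  each degree \<open>n\<close> with length \<open>n\<close>.\<close>

lemma card_P_eq_card_S:
  assumes "k \<ge> 1"
  shows "card {xs \<in> partitions n. cond_P k xs} = card {xs \<in> partitions n. cond_S k xs}"
proof -
  let ?Q = "3 * k + 3"
  let ?R = "{x. x mod ?Q \<in> {2, 3 * k + 1}}" and ?M = "\<lambda>m. {x :: nat. m dvd x}"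
  define S where "S = Abs_fps (\<lambda>n. rat_of_nat (card {xs \<in> partitions n. cond_S k xs}))"
  have R3: "\<not> 3 dvd x" if "x \<in> ?R" for x
  proof -
    have "x mod 3 = (x mod ?Q) mod 3" by (rule mod_mod_cancel[symmetric]) presburger
    then show ?thesis using that by (auto simp: dvd_eq_mod_eq_0)
  qed
  have "S * parts_gf (?M ?Q) = parts_gf (range (site k)) * parts_gf (?M 3)"
  proof (rule fps_ext)
    fix n
    let ?G = "\<lambda>R. gf (chain_lists R n) sum_list"
    have "fps_nth (S * parts_gf (?M ?Q)) n = fps_nth (?G (S_rel k) * ?G (ge_in (?M ?Q))) n"
      by (rule fps_mult_nth_cong)
        (use assms in \<open>simp_all add: S_def fps_nth_chain_lists_S fps_nth_chain_lists_parts\<close>)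
    also have "?G (S_rel k) * ?G (ge_in (?M ?Q)) = ?G (ge_in (range (site k))) * ?G (ge_in (?M 3))"
      unfolding S_factor[OF assms] site_parts_factor[OF assms] by (simp only: mult_ac)
    also have "fps_nth \<dots> n = fps_nth (parts_gf (range (site k)) * parts_gf (?M 3)) n"
    proof (rule fps_mult_nth_cong)
      have "0 \<in> range (site k)" by (rule range_eqI[of _ _ 0]) simp
      then show "fps_nth (?G (ge_in (range (site k)))) i = fps_nth (parts_gf (range (site k))) i"
        if "i \<le> n" for i using that by (rule fps_nth_chain_lists_parts)
    qed (simp add: fps_nth_chain_lists_parts)
    finally show "fps_nth (S * parts_gf (?M ?Q)) n = fps_nth (parts_gf (range (site k)) * parts_gf (?M 3)) n" .
  qed
  also have "parts_gf (range (site k)) = parts_gf (?M ?Q) * parts_gf ?R"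
    unfolding range_site[OF assms] by (rule parts_gf_Un) (auto simp: dvd_eq_mod_eq_0)
  also have "\<dots> * parts_gf (?M 3) = parts_gf (?M 3) * parts_gf ?R * parts_gf (?M ?Q)"
    by (simp only: mult_ac)
  also have "parts_gf (?M 3) * parts_gf ?R = parts_gf (?M 3 \<union> ?R)"
    by (rule parts_gf_Un[symmetric]) (use R3 in blast)
  also have "?M 3 \<union> ?R = {m. admissible_part k m}"
    unfolding admissible_part_iff[OF assms] by blast
  finally have "S * parts_gf (?M ?Q) = gf_P k * parts_gf (?M ?Q)"
    unfolding gf_P_eq .
  then have "S = gf_P k"
    by (simp only: mult_right_cancel[OF parts_gf_nonzero])
  then have "fps_nth (gf_P k) n = fps_nth S n" by simp
  then show ?thesis by (simp add: S_def gf_P_def)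
qed

section \<open>Conjugation\<close>

text \<open>The parts of the conjugate larger than \<open>x\<close> are the rows that meet column \<open>x\<close> (counted from 0),
  and this column of the conjugate is row \<open>x\<close> of the partition.\<close>

lemma num_greater_conjugate:
  assumes "is_partition xs" "x \<le> length xs"
  shows "num_greater (conjugate xs) x = (xs @ [0]) ! x"
proof -
  let ?ys = "conjugate xs"
  have "num_greater ?ys x = card {j. (j, x) \<in> ferrers ?ys}"
    by (simp add: num_greater_def length_filter_conv_card ferrers_def)
  also have "{j. (j, x) \<in> ferrers ?ys} = {..<(xs @ [0]) ! x}"
    unfolding conjugate(2)[OF assms(1)]
    using assms(2) by (auto simp: ferrers_def nth_append)
  finally show ?thesis by simp
qed

lemma count_list_add_num_greater:
  "count_list ys (Suc x) + num_greater ys (Suc x) = num_greater ys x"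
  by (induction ys) (auto simp: num_greater_def)

lemma set_conjugate_subset:
  assumes "is_partition xs" "x \<in> set (conjugate xs)"
  shows "0 < x \<and> x \<le> length xs"
proof -
  obtain j where j: "j < length (conjugate xs)" "conjugate xs ! j = x"
    using assms(2) by (auto simp: in_set_conv_nth)
  have "0 < x" using assms conjugate(1) by (auto simp: is_partition_def)
  then have "(j, x - 1) \<in> ferrers (conjugate xs)" using j by (simp add: ferrers_def)
  then have "(x - 1, j) \<in> ferrers xs" unfolding conjugate(2)[OF assms(1)] by simp
  then show ?thesis using \<open>0 < x\<close> by (auto simp: ferrers_def)
qed

text \<open>Only values of \<open>x\<close> that are parts of the conjugate are tested by (C); for the other ones the
  frequency, hence the difference, is 0, on which the conditions impose nothing.\<close>

lemma cond_C_conjugate_iff: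
  assumes "is_partition xs"
  shows "cond_C k (conjugate xs) \<longleftrightarrow> difference_conditions k (xs @ [0])"
proof -
  let ?ys = "conjugate xs" and ?zs = "xs @ [0]"
  define ok where "ok d y \<longleftrightarrow> d \<noteq> 1 \<and> (d \<in> prog2 k \<longrightarrow> \<not> [y = 2] (mod 3)) \<and>
    (d \<in> prog4 k \<longrightarrow> [y = 1] (mod 3))" for d y :: nat
  have count: "count_list ?ys (Suc i) = ?zs ! i - ?zs ! Suc i"
      and greater: "num_greater ?ys (Suc i) = ?zs ! Suc i" if "i < length xs" for i
    using count_list_add_num_greater[of ?ys i] num_greater_conjugate[OF assms, of i]
      num_greater_conjugate[OF assms, of "Suc i"] that by simp_all
  have ok0: "ok 0 y" for y by (auto simp: ok_def prog2_def prog4_def)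
  have "difference_conditions k ?zs \<longleftrightarrow> (\<forall>i<length xs. ok (count_list ?ys (Suc i)) (num_greater ?ys (Suc i)))"
    by (auto simp: difference_conditions_def ok_def count greater)
  also have "\<dots> \<longleftrightarrow> (\<forall>x\<in>set ?ys. ok (count_list ?ys x) (num_greater ?ys x))"
  proof (intro iffI ballI allI impI)
    fix x assume "\<forall>i<length xs. ok (count_list ?ys (Suc i)) (num_greater ?ys (Suc i))" "x \<in> set ?ys"
    then show "ok (count_list ?ys x) (num_greater ?ys x)"
      using set_conjugate_subset[OF assms, of x] by (cases x) auto
  next
    fix i assume "\<forall>x\<in>set ?ys. ok (count_list ?ys x) (num_greater ?ys x)"
    then show "ok (count_list ?ys (Suc i)) (num_greater ?ys (Suc i))"
      using ok0 by (cases "Suc i \<in> set ?ys") (auto simp: count_list_0_iff)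
  qed
  also have "\<dots> \<longleftrightarrow> cond_C k ?ys" by (simp add: cond_C_def ok_def)
  finally show ?thesis by blast
qed

theorem mainTheorem1:
  fixes k :: nat
  assumes "k \<ge> 1"
  shows "(\<forall>n. card {xs \<in> partitions n. cond_P k xs} = card {xs \<in> partitions n. cond_S k xs})
    \<and> (\<forall>xs. is_partition xs \<longrightarrow> (cond_S k xs \<longleftrightarrow> difference_conditions k (xs @ [0])))
    \<and> (\<forall>m. admissible_part k (m + (3 * k + 3)) \<longleftrightarrow> admissible_part k m)
    \<and> (\<lambda>m. if admissible_part k (Suc m) then inverse (1 - fps_X ^ Suc m) else 1) has_prod gf_P k
    \<and> (\<forall>xs. is_partition xs \<longrightarrow> (cond_S k xs \<longleftrightarrow> cond_C k (conjugate xs)))"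
proof (intro conjI allI impI)
  show "card {xs \<in> partitions n. cond_P k xs} = card {xs \<in> partitions n. cond_S k xs}" for n
    by (rule card_P_eq_card_S[OF assms])
  show zero: "cond_S k xs \<longleftrightarrow> difference_conditions k (xs @ [0])" if "is_partition xs" for xs
    unfolding cond_S_iff_successively[OF assms that]
    by (rule difference_conditions_iff[OF sorted_append_0[OF that], symmetric])
  show "cond_S k xs \<longleftrightarrow> cond_C k (conjugate xs)" if "is_partition xs" for xs
    unfolding zero[OF that] cond_C_conjugate_iff[OF that] ..
  show "admissible_part k (m + (3 * k + 3)) \<longleftrightarrow> admissible_part k m" for m
  proof -
    have "3 dvd 3 * k + 3" by simp
    then have "3 dvd m + (3 * k + 3) \<longleftrightarrow> 3 dvd m" by (rule dvd_add_left_iff)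
    then show ?thesis unfolding admissible_part_iff[OF assms] mod_add_self2 by simp
  qed
  show "(\<lambda>m. if admissible_part k (Suc m) then inverse (1 - fps_X ^ Suc m) else 1) has_prod gf_P k"
    using has_prod_parts_gf[of "{m. admissible_part k m}"] by (simp only: gf_P_eq mem_Collect_eq)
qed

end
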